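(* Let $a\in\mathbb R$, $a\neq0$. The weight matrix $$W(x)=e^{-x^2}\begin{pmatrix}1+a^2x^2&ax\\ ax&1\end{pmatrix},\qquad x\in\mathbb R,$$ is a strong Darboux transformation of $\widetilde W(x)=e^{-x^2}I$ (of size $2\times2$, on $\mathbb R$).
   Context: For a weight matrix $W$ of size $N$ on an interval $(x_0,x_1)$ put $\langle P,Q\rangle_W=\int_{x_0}^{x_1}P(x)W(x)Q(x)^*\,dx$ for $P,Q\in\operatorname{Mat}_N(\mathbb C[x])$. The monic orthogonal polynomials of $W$ are the unique $P_n\in\operatorname{Mat}_N(\mathbb C[x])$, $n\ge0$, of degree $n$ with leading coefficient $I$ and $\langle P_n,P_m\rangle_W=0$ for $n\ne m$. Differential operators $D=\sum_{i=0}^s\partial^iF_i(x)$, $\partial=d/dx$, act on the right on matrix functions: $P\cdot D=\sum_i P^{(i)}F_i$, and products satisfy $P\cdot(D_1D_2)=(P\cdot D_1)\cdot D_2$. $\operatorname{Mat}_N(\Omega[x])$ is the algebra of such operators with coefficients $F_i\in\operatorname{Mat}_N(\mathbb C[x])$. $$\mathcal D(W)=\{D\in\operatorname{Mat}_N(\Omega[x]): P_n\cdot D=\Lambda_n(D)P_n\text{ for some }\Lambda_n(D)\in\operatorname{Mat}_N(\mathbb C),\ \forall n\ge0\}.$$ The formal adjoint ${}^*$ is the involution (reversing products) extending the Hermitian conjugate on matrix functions and sending $\partial I$ to $-\partial I$. An operator $\mathcal V\in\operatorname{Mat}_N(\Omega[x])$ is degree-preserving if $\deg(P\cdot\mathcal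 V)=\deg P$ for all $P\in\operatorname{Mat}_N(\mathbb C[x])$. Strong Darboux transformation (general definition): for weight matrices $W_1,W_2$ of size $N$ on the same interval, $W_2$ is a strong Darboux transformation of $W_1$ if there is a degree-preserving differential operator $\mathcal V\in\operatorname{Mat}_N(\Omega[x])$ with nonsingular leading coefficient (i.e. the coefficient of its highest power of $\partial$ is a matrix polynomial whose determinant is not identically zero) such that $D=\mathcal V\mathcal N\in\mathcal D(W_1)$, where $\mathcal N=W_2\mathcal V^*W_1^{-1}$ (so $Q\cdot\mathcal N=\sum_j(-1)^j(QW_2F_j^* )^{(j)}W_1^{-1}$ if $\mathcal V=\sum_j\partial^jF_j$) is a differential operator satisfying $\langle P\cdot\mathcal V,Q\rangle_{W_2}=\langle P,Q\cdot\mathcal N\rangle_{W_1}$ for all $P,Q\in\operatorname{Mat}_N(\mathbb C[x])$. *)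

theory Defs
  imports "HOL-Analysis.Analysis" "HOL-Computational_Algebra.Polynomial"
begin

type_synonym 'n matpoly = "(complex poly)^'n^'n"
type_synonym 'n matfun = "real \<Rightarrow> complex^'n^'n"

definition conj_transpose :: "complex^'n^'n \<Rightarrow> complex^'n^'n" where
  "conj_transpose A = (\<chi> i j. cnj (A $ j $ i))"

definition positive_definite :: "complex^'n^'n \<Rightarrow> bool" where
  "positive_definite A \<longleftrightarrow> conj_transpose A = A \<and>
     (\<forall>v. v \<noteq> 0 \<longrightarrow> 0 < Re (\<Sum>i\<in>UNIV. \<Sum>j\<in>UNIV. cnj (v $ i) * A $ i $ j * v $ j))"

definition nderiv :: "nat \<Rightarrow> (real \<Rightarrow> 'a::real_normed_vector) \<Rightarrow> real \<Rightarrow> 'a" where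
  "nderiv k = (\<lambda>f x. vector_derivative f (at x)) ^^ k"

definition smooth_fun_on :: "real set \<Rightarrow> (real \<Rightarrow> 'a::real_normed_vector) \<Rightarrow> bool" where
  "smooth_fun_on S f \<longleftrightarrow> (\<forall>k. \<forall>x\<in>S. nderiv k f differentiable (at x))"


text \<open>The interval \<open>(x0, x1)\<close> may be unbounded, hence the extended real end points.\<close>

definition weight_matrix :: "ereal \<Rightarrow> ereal \<Rightarrow> 'n::finite matfun \<Rightarrow> bool" where
  "weight_matrix x0 x1 W \<longleftrightarrow> x0 < x1 \<and> smooth_fun_on (einterval x0 x1) W \<and>
     (AE x in lborel. x \<in> einterval x0 x1 \<longrightarrow> positive_definite (W x)) \<and>
     (\<forall>n::nat. set_integrable lborel (einterval x0 x1) (\<lambda>x. x ^ n *\<^sub>R W x))"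

definition weight_inner ::
  "ereal \<Rightarrow> ereal \<Rightarrow> 'n::finite matfun \<Rightarrow> 'n matfun \<Rightarrow> 'n matfun \<Rightarrow> complex^'n^'n" where
  "weight_inner x0 x1 W P Q =
     (LINT x:einterval x0 x1|lborel. P x ** W x ** conj_transpose (Q x))"


definition matpoly_fun :: "'n::finite matpoly \<Rightarrow> 'n matfun" where
  "matpoly_fun P x = (\<chi> i j. poly (P $ i $ j) (of_real x))"

definition const_matpoly :: "complex^'n^'n \<Rightarrow> 'n::finite matpoly" where
  "const_matpoly A = (\<chi> i j. [:A $ i $ j:])"

definition matpoly_coeff :: "'n::finite matpoly \<Rightarrow> nat \<Rightarrow> complex^'n^'n" where
  "matpoly_coeff P k = (\<chi> i j. coeff (P $ i $ j) k)"

text \<open>The zero polynomial has degree \<open>-\<infinity>\<close>. With the library's convention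
  \<open>degree 0 = 0\<close>, a degree-preserving operator could annihilate constants.\<close>

definition matpoly_degree :: "'n::finite matpoly \<Rightarrow> ereal" where
  "matpoly_degree P =
     (if P = 0 then -\<infinity> else ereal (real (Max (range (\<lambda>(i, j). degree (P $ i $ j))))))"

definition monic_orthogonal ::
  "ereal \<Rightarrow> ereal \<Rightarrow> 'n::finite matfun \<Rightarrow> (nat \<Rightarrow> 'n matpoly) \<Rightarrow> bool" where
  "monic_orthogonal x0 x1 W P \<longleftrightarrow>
     (\<forall>n. matpoly_degree (P n) = ereal (real n) \<and> matpoly_coeff (P n) n = mat 1) \<and>
     (\<forall>n m. n \<noteq> m \<longrightarrow>
        weight_inner x0 x1 W (matpoly_fun (P n)) (matpoly_fun (P m)) = 0)"


text \<open>An operator \<open>D = \<Sum>\<^sub>i \<partial>\<^sup>i F\<^sub>i\<close> with matrix polynomial coefficients is encoded as the polynomial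
  in \<open>\<partial>\<close> whose \<open>i\<close>-th coefficient is \<open>F\<^sub>i\<close>. Only the coefficient sequence, the degree and
  the leading coefficient of that polynomial are meaningful: multiplication of operators is
  composition of the right actions.\<close>

type_synonym 'n matpoly_diffop = "'n matpoly poly"

definition diffop_poly :: "'n::finite matpoly \<Rightarrow> 'n matpoly_diffop \<Rightarrow> 'n matpoly" where
  "diffop_poly P D =
     (\<Sum>i\<le>degree D. (\<chi> k l. (pderiv ^^ i) (P $ k $ l)) ** coeff D i)"

text \<open>An operator with matrix function coefficients is the list of its coefficients
  \<open>[F\<^sub>0, F\<^sub>1, \<dots>]\<close>.\<close>

definition diffop_fun :: "'n::finite matfun \<Rightarrow> 'n matfun list \<Rightarrow> 'n matfun" where
  "diffop_fun Q Fs x = (\<Sum>i<length Fs. nderiv i Q x ** (Fs ! i) x)"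

definition fun_coeffs :: "'n::finite matpoly_diffop \<Rightarrow> 'n matfun list" where
  "fun_coeffs D = map matpoly_fun (coeffs D)"

definition degree_preserving :: "'n::finite matpoly_diffop \<Rightarrow> bool" where
  "degree_preserving V \<longleftrightarrow> (\<forall>P. matpoly_degree (diffop_poly P V) = matpoly_degree P)"

text \<open>A weight matrix has exactly one sequence of monic orthogonal polynomials, so the existential
  quantifier over \<open>P\<close> refers to that sequence.\<close>

definition diffop_algebra ::
  "ereal \<Rightarrow> ereal \<Rightarrow> 'n::finite matfun \<Rightarrow> 'n matpoly_diffop set" where
  "diffop_algebra x0 x1 W =
     {D. \<exists>P. monic_orthogonal x0 x1 W P \<and>
             (\<forall>n. \<exists>L. diffop_poly (P n) D = const_matpoly L ** P n)}"

text \<open>The action \<open>Q \<cdot> (W\<^sub>2 V\<^sup>* W\<^sub>1\<^sup>-\<^sup>1)\<close>, with \<open>(\<partial>\<^sup>j F\<^sub>j)\<^sup>* = F\<^sub>j\<^sup>* (-\<partial>)\<^sup>j\<close>.\<close>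

definition weighted_adjoint ::
  "'n::finite matfun \<Rightarrow> 'n matfun \<Rightarrow> 'n matpoly_diffop \<Rightarrow> 'n matfun \<Rightarrow> 'n matfun" where
  "weighted_adjoint W1 W2 V Q x =
     (\<Sum>j\<le>degree V. (-1) ^ j *\<^sub>R
        nderiv j (\<lambda>t. Q t ** W2 t ** conj_transpose (matpoly_fun (coeff V j) t)) x)
     ** matrix_inv (W1 x)"

text \<open>\<open>N\<close> is the operator \<open>W\<^sub>2 V\<^sup>* W\<^sub>1\<^sup>-\<^sup>1\<close>: a weight is invertible almost everywhere on the interval
  and the coefficients of \<open>N\<close> are continuous, so they are determined by the values at the points where
  \<open>W\<^sub>1\<close> is invertible. The equation \<open>D = V N\<close> is equality of the right actions on smooth
  matrix functions. Integrability is part of the adjointness condition because the integral of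
  a non-integrable function is \<open>0\<close> in the library.\<close>

definition strong_darboux_transformation ::
  "ereal \<Rightarrow> ereal \<Rightarrow> 'n::finite matfun \<Rightarrow> 'n matfun \<Rightarrow> bool" where
  "strong_darboux_transformation x0 x1 W1 W2 \<longleftrightarrow>
     weight_matrix x0 x1 W1 \<and> weight_matrix x0 x1 W2 \<and>
     (\<exists>(V :: 'n matpoly_diffop) (N :: 'n matfun list) (D :: 'n matpoly_diffop).
        degree_preserving V \<and> det (lead_coeff V) \<noteq> 0 \<and>
        (\<forall>G\<in>set N. smooth_fun_on (einterval x0 x1) G) \<and>
        (\<forall>Q x. smooth_fun_on (einterval x0 x1) Q \<longrightarrow> x \<in> einterval x0 x1 \<longrightarrow>
           invertible (W1 x) \<longrightarrow> diffop_fun Q N x = weighted_adjoint W1 W2 V Q x) \<and>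
        D \<in> diffop_algebra x0 x1 W1 \<and>
        (\<forall>Q x. smooth_fun_on (einterval x0 x1) Q \<longrightarrow> x \<in> einterval x0 x1 \<longrightarrow>
           diffop_fun Q (fun_coeffs D) x = diffop_fun (diffop_fun Q (fun_coeffs V)) N x) \<and>
        (\<forall>P Q. set_integrable lborel (einterval x0 x1)
             (\<lambda>x. matpoly_fun P x ** W1 x ** conj_transpose (diffop_fun (matpoly_fun Q) N x)) \<and>
           weight_inner x0 x1 W2 (matpoly_fun (diffop_poly P V)) (matpoly_fun Q) =
           weight_inner x0 x1 W1 (matpoly_fun P) (diffop_fun (matpoly_fun Q) N)))"

end

(* Write W = exp(-x^2) T T* with T = [[1, a x], [0, 1]], and let h_n be the monic Hermite polynomials.
   The action V T sends h_n e_1 to (h_n, a h_{n+1}) and h_n e_2 to (- a n h_{n-1} / 2, h_n), all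
   mutually orthogonal for exp(-x^2); this gives the first order operator V = I + d F with
   F = [[0, -a/2], [-a/2, a^2 x / 2]].  The adjoint N of V has polynomial coefficients because
   W F = - exp(-x^2) B with B = [[a^2 x / 2, a/2], [a/2, 0]], and V N is
   - (a^2 / 4) (d^2 - d 2 x) + diag (1 + a^2 / 2, 1), hence diagonal in the Hermite basis. *)
theory Submission
  imports Defs "HOL-Probability.Distributions" "HOL-Real_Asymp.Real_Asymp"
begin

section \<open>Derivatives of matrix-valued functions\<close>

lemma scaleR_matrix_mult_left: "(c *\<^sub>R A) ** B = c *\<^sub>R (A ** (B :: complex^'n^'m))"
  by (simp add: vec_eq_iff matrix_matrix_mult_def scaleR_sum_right)

lemma scaleR_matrix_mult_right: "A ** (c *\<^sub>R B) = c *\<^sub>R (A ** (B :: complex^'n^'m))"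
  by (simp add: vec_eq_iff matrix_matrix_mult_def scaleR_sum_right)

lemma matrix_add_rdistrib: "(A + B) ** C = A ** C + B ** C"
  by (simp add: vec_eq_iff matrix_matrix_mult_def sum.distrib distrib_right)

text \<open>In finite dimension bilinearity implies boundedness, so the general product rule for
  bounded bilinear maps applies and keeps the order of the factors.\<close>

lemma bounded_bilinear_matrix_mult:
  "bounded_bilinear ((**) :: complex^'n^'m \<Rightarrow> complex^'k^'n \<Rightarrow> complex^'k^'m)"
  unfolding bilinear_conv_bounded_bilinear[symmetric] bilinear_def
  by (auto intro!: linearI simp: matrix_add_ldistrib matrix_add_rdistrib
      scaleR_matrix_mult_left scaleR_matrix_mult_right)

lemmas has_vector_derivative_matrix_mult =
  bounded_bilinear.has_vector_derivative[OF bounded_bilinear_matrix_mult]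

lemma has_vector_derivative_vec_lambda:
  assumes "\<And>i. ((\<lambda>x. f x $ i) has_vector_derivative f' $ i) F"
  shows "(f has_vector_derivative (f' :: 'a::euclidean_space^'n)) F"
  using assms unfolding has_vector_derivative_def has_derivative_def
  by (auto intro!: vec_tendstoI bounded_linear_scaleR_left)

section \<open>Algebra and calculus of matrix polynomials\<close>

definition matpoly_deriv :: "'n::finite matpoly \<Rightarrow> 'n matpoly" where
  "matpoly_deriv P = (\<chi> i j. pderiv (P $ i $ j))"

text \<open>The Hermitian conjugate taken on coefficients, which stays polynomial. It agrees with
  \<open>conj_transpose\<close> of the values because all arguments are real.\<close>

definition matpoly_adj :: "'n::finite matpoly \<Rightarrow> 'n matpoly" where
  "matpoly_adj P = (\<chi> i j. map_poly cnj (P $ j $ i))"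

lemma matpoly_fun_add: "matpoly_fun (P + Q) x = matpoly_fun P x + matpoly_fun Q x"
  by (simp add: matpoly_fun_def vec_eq_iff)

lemma matpoly_fun_diff: "matpoly_fun (P - Q) x = matpoly_fun P x - matpoly_fun Q x"
  by (simp add: matpoly_fun_def vec_eq_iff)

lemma matpoly_fun_minus: "matpoly_fun (- P) x = - matpoly_fun P x"
  by (simp add: matpoly_fun_def vec_eq_iff)

lemma matpoly_fun_mult: "matpoly_fun (P ** Q) x = matpoly_fun P x ** matpoly_fun Q x"
  by (simp add: matpoly_fun_def matrix_matrix_mult_def vec_eq_iff poly_sum)

lemma matpoly_fun_mat: "matpoly_fun (mat p) x = mat (poly p (of_real x))"
  by (simp add: matpoly_fun_def mat_def vec_eq_iff)

lemma matpoly_fun_adj: "matpoly_fun (matpoly_adj P) x = conj_transpose (matpoly_fun P x)"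
  by (simp add: matpoly_fun_def matpoly_adj_def conj_transpose_def vec_eq_iff
      poly_cnj[of _ "of_real x", simplified])

lemma pderiv_sum: "pderiv (sum f A) = (\<Sum>x\<in>A. pderiv (f x))"
  by (induction A rule: infinite_finite_induct) (auto simp: pderiv_add)

lemma matpoly_deriv_mult: "matpoly_deriv (P ** Q) = matpoly_deriv P ** Q + P ** matpoly_deriv Q"
  by (simp add: matpoly_deriv_def vec_eq_iff matrix_matrix_mult_def pderiv_sum pderiv_mult
      sum.distrib algebra_simps)

lemma matpoly_adj_add: "matpoly_adj (P + Q) = matpoly_adj P + matpoly_adj Q"
  by (simp add: matpoly_adj_def vec_eq_iff poly_eq_iff coeff_map_poly)

lemma matpoly_adj_mult: "matpoly_adj (P ** Q) = matpoly_adj Q ** matpoly_adj P"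
  by (simp add: matpoly_adj_def vec_eq_iff poly_eq_iff coeff_map_poly matrix_matrix_mult_def
      coeff_sum coeff_mult mult.commute)

lemma matpoly_adj_deriv: "matpoly_adj (matpoly_deriv P) = matpoly_deriv (matpoly_adj P)"
  by (simp add: matpoly_adj_def matpoly_deriv_def vec_eq_iff poly_eq_iff coeff_map_poly coeff_pderiv)

lemma matpoly_deriv_funpow: "(matpoly_deriv ^^ i) P $ k $ l = (pderiv ^^ i) (P $ k $ l)"
  by (induction i) (auto simp: matpoly_deriv_def)

lemma diffop_poly_altdef:
  "diffop_poly P D = (\<Sum>i\<le>degree D. (matpoly_deriv ^^ i) P ** coeff D i)"
  unfolding diffop_poly_def
  by (intro sum.cong refl arg_cong2[where f = "(**)"]) (simp add: vec_eq_iff matpoly_deriv_funpow)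

lemma has_vector_derivative_matpoly_fun:
  "(matpoly_fun P has_vector_derivative matpoly_fun (matpoly_deriv P) x) (at x)"
proof (intro has_vector_derivative_vec_lambda)
  fix i j
  \<comment> \<open>The factor \<open>1\<close> is the derivative of the inner map
    \<open>of_real\<close> in the chain rule.\<close>
  have "((\<lambda>x. poly (P $ i $ j) (of_real x)) has_vector_derivative
      1 * poly (pderiv (P $ i $ j)) (of_real x)) (at x)"
    by (rule field_vector_diff_chain_at[of _ 1, unfolded o_def])
       (auto intro!: derivative_eq_intros has_vector_derivative_of_real poly_DERIV)
  thus "((\<lambda>x. matpoly_fun P x $ i $ j) has_vector_derivative
      matpoly_fun (matpoly_deriv P) x $ i $ j) (at x)"
    by (simp add: matpoly_fun_def matpoly_deriv_def)
qed

section \<open>Iterated derivatives and smoothness\<close>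

lemma nderiv_0 [simp]: "nderiv 0 f = f"
  by (simp add: nderiv_def)

lemma nderiv_Suc: "nderiv (Suc k) f x = vector_derivative (nderiv k f) (at x)"
  by (simp add: nderiv_def)

text \<open>If differentiation maps a parametrised family into itself, analysis turns into algebra
  on the parameters. This serves both \<open>matpoly_fun\<close> and
  \<open>gauss_fun\<close>.\<close>

lemma nderiv_by_invariant_family:
  assumes "\<And>P x. (g P has_vector_derivative g (d P) x) (at x)"
  shows "nderiv k (g P) = g ((d ^^ k) P)"
proof (induction k)
  case (Suc k)
  show ?case
    by (rule ext) (simp add: nderiv_Suc Suc vector_derivative_at[OF assms])
qed auto

lemma smooth_fun_on_invariant_family:
  assumes "\<And>P x. (g P has_vector_derivative g (d P) x) (at x)"
  shows "smooth_fun_on S (g P)"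
  unfolding smooth_fun_on_def nderiv_by_invariant_family[where d = d and g = g, OF assms]
  using assms differentiableI_vector by blast

lemmas nderiv_matpoly_fun =
  nderiv_by_invariant_family[where g = matpoly_fun, OF has_vector_derivative_matpoly_fun]

lemmas smooth_fun_on_matpoly_fun =
  smooth_fun_on_invariant_family[where g = matpoly_fun, OF has_vector_derivative_matpoly_fun]

lemma smooth_fun_on_nderiv:
  assumes "smooth_fun_on S f" "x \<in> S"
  shows "(nderiv k f has_vector_derivative nderiv (Suc k) f x) (at x)"
  using assms unfolding smooth_fun_on_def nderiv_Suc by (simp add: vector_derivative_works[symmetric])

section \<open>Degrees through coefficient matrices\<close>

lemma matpoly_coeff_bound: "\<exists>d. \<forall>k>d. matpoly_coeff P k = 0"
proof (intro exI allI impI)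
  fix k assume k: "k > Max (range (\<lambda>(i, j). degree (P $ i $ j)))"
  have "degree (P $ i $ j) < k" for i j
    by (rule le_less_trans[OF Max_ge k]) (auto intro: rev_image_eqI[of "(i, j)"])
  thus "matpoly_coeff P k = 0"
    by (simp add: matpoly_coeff_def vec_eq_iff coeff_eq_0)
qed

lemma matpoly_eq_0_iff: "P = 0 \<longleftrightarrow> (\<forall>k. matpoly_coeff P k = 0)"
  by (auto simp: matpoly_coeff_def vec_eq_iff poly_eq_iff)

lemma matpoly_degree_eqI:
  assumes "matpoly_coeff P n \<noteq> 0" "\<And>k. k > n \<Longrightarrow> matpoly_coeff P k = 0"
  shows "matpoly_degree P = ereal (real n)"
proof -
  have "Max (range (\<lambda>(i, j). degree (P $ i $ j))) = n"
  proof (rule Max_eqI)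
    fix y assume "y \<in> range (\<lambda>(i, j). degree (P $ i $ j))"
    thus "y \<le> n"
      using assms(2) by (auto intro!: degree_le simp: matpoly_coeff_def vec_eq_iff)
  next
    obtain i j where ij: "coeff (P $ i $ j) n \<noteq> 0"
      using assms(1) by (auto simp: matpoly_coeff_def vec_eq_iff)
    have "degree (P $ i $ j) = n"
      using assms(2) ij
      by (intro antisym degree_le le_degree) (auto simp: matpoly_coeff_def vec_eq_iff)
    thus "n \<in> range (\<lambda>(i, j). degree (P $ i $ j))"
      by (auto intro: rev_image_eqI[of "(i, j)"])
  qed auto
  moreover have "P \<noteq> 0"
    using assms(1) by (auto simp: matpoly_eq_0_iff)
  ultimately show ?thesis
    by (simp add: matpoly_degree_def)
qed

text \<open>Only the top nonzero coefficient matrix matters: the operator must create nothing above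
  it and must not annihilate it. The zero polynomial has degree minus infinity and is treated
  separately.\<close>

lemma degree_preservingI:
  assumes zero: "diffop_poly 0 V = 0"
  assumes le: "\<And>P n. (\<And>k. k > n \<Longrightarrow> matpoly_coeff P k = 0) \<Longrightarrow>
    (\<forall>k>n. matpoly_coeff (diffop_poly P V) k = 0)"
  assumes lead: "\<And>P n. (\<And>k. k > n \<Longrightarrow> matpoly_coeff P k = 0) \<Longrightarrow>
    matpoly_coeff P n \<noteq> 0 \<Longrightarrow> matpoly_coeff (diffop_poly P V) n \<noteq> 0"
  shows "degree_preserving V"
  unfolding degree_preserving_def
proof
  fix P :: "'a matpoly"
  show "matpoly_degree (diffop_poly P V) = matpoly_degree P"
  proof (cases "P = 0")
    case False
    obtain d where d: "\<forall>k>d. matpoly_coeff P k = 0"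
      using matpoly_coeff_bound by blast
    \<comment> \<open>The index of the leading coefficient; the maximum exists because the indices
      of nonzero coefficients are bounded by \<open>d\<close>.\<close>
    define n where "n = (GREATEST k. matpoly_coeff P k \<noteq> 0)"
    obtain k where k: "matpoly_coeff P k \<noteq> 0"
      using False by (auto simp: matpoly_eq_0_iff)
    have b: "\<And>k. matpoly_coeff P k \<noteq> 0 \<Longrightarrow> k \<le> d"
      using d not_le by blast
    have n: "matpoly_coeff P n \<noteq> 0"
      unfolding n_def by (rule GreatestI_nat[of "\<lambda>k. matpoly_coeff P k \<noteq> 0", OF k b])
    have above: "matpoly_coeff P k = 0" if "k > n" for k
      using that Greatest_le_nat[of "\<lambda>k. matpoly_coeff P k \<noteq> 0" k d] b
      unfolding n_def by fastforce
    show ?thesis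
      using le[OF above] lead[OF above n] n above by (simp add: matpoly_degree_eqI)
  qed (simp add: zero)
qed

text \<open>Monomials with constant matrix coefficients reduce integrability and decay of
  \<open>gauss_fun\<close> to the scalar functions exp(-x^2) x^k.\<close>

lemma matpoly_fun_expand: "\<exists>d. \<forall>x. matpoly_fun P x = (\<Sum>k\<le>d. x ^ k *\<^sub>R matpoly_coeff P k)"
proof -
  obtain d where d: "\<forall>k>d. matpoly_coeff P k = 0"
    using matpoly_coeff_bound by blast
  have "poly (P $ i $ j) (of_real x) = (\<Sum>k\<le>d. x ^ k *\<^sub>R coeff (P $ i $ j) k)" for i j x
  proof -
    have *: "degree (P $ i $ j) \<le> d"
      using d by (intro degree_le) (auto simp: matpoly_coeff_def vec_eq_iff)
    show ?thesis
      unfolding poly_altdef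
      by (intro sum.mono_neutral_cong_left)
         (use * in \<open>auto simp: coeff_eq_0 scaleR_conv_of_real\<close>)
  qed
  thus ?thesis
    by (intro exI[of _ d]) (simp add: matpoly_fun_def matpoly_coeff_def vec_eq_iff)
qed

section \<open>Matrix polynomials times the Gaussian\<close>

definition gauss_fun :: "'n::finite matpoly \<Rightarrow> 'n matfun" where
  "gauss_fun P x = exp (- (x ^ 2)) *\<^sub>R matpoly_fun P x"

text \<open>Differentiation conjugated by the Gaussian: (e^(-x^2) P)' = e^(-x^2) (P' - 2 x
  P).\<close>

definition gauss_deriv :: "'n::finite matpoly \<Rightarrow> 'n matpoly" where
  "gauss_deriv P = matpoly_deriv P - (\<chi> i j. [:0, 2:] * P $ i $ j)"

lemma has_vector_derivative_gauss_fun: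
  "(gauss_fun P has_vector_derivative gauss_fun (gauss_deriv P) x) (at x)"
proof -
  have "((\<lambda>x. exp (- (x ^ 2)) *\<^sub>R matpoly_fun P x) has_vector_derivative
     exp (- (x ^ 2)) *\<^sub>R matpoly_fun (matpoly_deriv P) x +
     (exp (- (x ^ 2)) * (- 2 * x)) *\<^sub>R matpoly_fun P x) (at x)"
    by (intro has_vector_derivative_scaleR has_vector_derivative_matpoly_fun)
       (auto intro!: derivative_eq_intros)
  also have "exp (- (x ^ 2)) *\<^sub>R matpoly_fun (matpoly_deriv P) x +
     (exp (- (x ^ 2)) * (- 2 * x)) *\<^sub>R matpoly_fun P x = gauss_fun (gauss_deriv P) x"
    unfolding gauss_fun_def gauss_deriv_def matpoly_fun_diff
    by (simp add: vec_eq_iff matpoly_fun_def) (simp add: scaleR_conv_of_real algebra_simps)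
  finally show ?thesis
    by (simp add: gauss_fun_def[abs_def])
qed

lemmas smooth_fun_on_gauss_fun =
  smooth_fun_on_invariant_family[where g = gauss_fun, OF has_vector_derivative_gauss_fun]

lemma integrable_power_gauss: "integrable lborel (\<lambda>x::real. exp (- (x ^ 2)) * x ^ k)"
proof -
  \<comment> \<open>The normal density with mean 0 and standard deviation 1 / sqrt 2 is exp(-x^2) /
    sqrt pi, so its known moments give the claim.\<close>
  have "integrable lborel (\<lambda>x. sqrt pi * (normal_density 0 (1 / sqrt 2) x * (x - 0) ^ k))"
    by (intro integrable_mult_right integrable_normal_moment) auto
  also have "(\<lambda>x. sqrt pi * (normal_density 0 (1 / sqrt 2) x * (x - 0) ^ k)) =
      (\<lambda>x. exp (- (x ^ 2)) * x ^ k)"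
    by (auto simp: normal_density_def power_divide field_simps)
  finally show ?thesis .
qed

lemma integrable_gauss_fun: "integrable lborel (gauss_fun P)"
proof -
  obtain d where d: "\<forall>x. matpoly_fun P x = (\<Sum>k\<le>d. x ^ k *\<^sub>R matpoly_coeff P k)"
    using matpoly_fun_expand by blast
  have "integrable lborel (\<lambda>x. \<Sum>k\<le>d. (exp (- (x ^ 2)) * x ^ k) *\<^sub>R matpoly_coeff P k)"
    by (intro Bochner_Integration.integrable_sum integrable_scaleR_left integrable_power_gauss)
  thus ?thesis
    by (simp add: gauss_fun_def[abs_def] d scaleR_sum_right)
qed

lemma gauss_fun_tendsto_0:
  assumes "\<And>k. ((\<lambda>x::real. exp (- (x ^ 2)) * x ^ k) \<longlongrightarrow> 0) F"
  shows "(gauss_fun P \<longlongrightarrow> 0) F"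
proof -
  obtain d where d: "\<forall>x. matpoly_fun P x = (\<Sum>k\<le>d. x ^ k *\<^sub>R matpoly_coeff P k)"
    using matpoly_fun_expand by blast
  have "((\<lambda>x. \<Sum>k\<le>d. (exp (- (x ^ 2)) * x ^ k) *\<^sub>R matpoly_coeff P k) \<longlongrightarrow> 
      (\<Sum>k\<le>d. 0 *\<^sub>R matpoly_coeff P k)) F"
    by (intro tendsto_intros assms)
  thus ?thesis
    by (simp add: gauss_fun_def[abs_def] d scaleR_sum_right)
qed

lemma gauss_fun_tendsto_at_top: "(gauss_fun P \<longlongrightarrow> 0) at_top"
  by (rule gauss_fun_tendsto_0) real_asymp

lemma gauss_fun_tendsto_at_bot: "(gauss_fun P \<longlongrightarrow> 0) at_bot"
proof (rule gauss_fun_tendsto_0)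
  fix k
  \<comment> \<open>Reflecting x to -x moves the limit to \<open>at_top\<close>, at the price of the
    sign (-1)^k.\<close>
  have "((\<lambda>x::real. (- 1) ^ k * (exp (- (x ^ 2)) * x ^ k)) \<longlongrightarrow> (- 1) ^ k * 0) at_top"
    by (intro tendsto_mult tendsto_const) real_asymp
  also have "(\<lambda>x::real. (- 1) ^ k * (exp (- (x ^ 2)) * x ^ k)) =
      (\<lambda>x. exp (- ((- x) ^ 2)) * (- x) ^ k)"
    by (subst (2) power_minus) (simp add: fun_eq_iff)
  finally show "((\<lambda>x::real. exp (- (x ^ 2)) * x ^ k) \<longlongrightarrow> 0) at_bot"
    by (subst filterlim_at_bot_mirror) simp
qed

definition gauss_integral :: "'n::finite matpoly \<Rightarrow> complex^'n^'n" where
  "gauss_integral P = integral\<^sup>L lborel (gauss_fun P)"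

lemma gauss_integral_add: "gauss_integral (P + Q) = gauss_integral P + gauss_integral Q"
proof -
  have "gauss_fun (P + Q) = (\<lambda>x. gauss_fun P x + gauss_fun Q x)"
    by (simp add: gauss_fun_def fun_eq_iff matpoly_fun_add scaleR_add_right)
  thus ?thesis
    by (simp add: gauss_integral_def integrable_gauss_fun)
qed

text \<open>Integration by parts in algebraic form: the integrand is an exact derivative and its
  primitive vanishes at both ends. Hermite orthogonality and the adjointness of \<open>V\<close> and
  \<open>N\<close> both rest on this.\<close>

lemma gauss_integral_gauss_deriv: "gauss_integral (gauss_deriv P) = 0"
proof -
  have "(LBINT x=-\<infinity>..\<infinity>. gauss_fun (gauss_deriv P) x) = 0 - 0"
  proof (rule interval_integral_FTC_integrable)
    show "isCont (gauss_fun (gauss_deriv P)) x" for x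
      using has_vector_derivative_gauss_fun has_vector_derivative_continuous by blast
    show "set_integrable lborel (einterval (-\<infinity>) \<infinity>) (gauss_fun (gauss_deriv P))"
      by (simp add: set_integrable_def integrable_gauss_fun)
  qed (auto intro: has_vector_derivative_gauss_fun gauss_fun_tendsto_at_top
        gauss_fun_tendsto_at_bot simp: ereal_tendsto_simps1)
  thus ?thesis
    by (simp add: gauss_integral_def interval_lebesgue_integral_def set_lebesgue_integral_def)
qed

section \<open>Matrix identities, and inner products and weights of Gaussian type\<close>

lemma matrix_minus_left: "(- A) ** B = - (A ** (B :: 'a::ring_1^'n^'m))"
  by (simp add: vec_eq_iff matrix_matrix_mult_def sum_negf)

lemma matrix_minus_right: "A ** (- B) = - (A ** (B :: 'a::ring_1^'n^'m))"
  by (simp add: vec_eq_iff matrix_matrix_mult_def sum_negf)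

lemma mat_mult_left: "mat c ** A = (\<chi> i j. (c :: 'a::semiring_1) * A $ i $ j)"
  by (simp add: vec_eq_iff matrix_matrix_mult_def mat_def if_distrib if_distribR cong: if_cong)

lemma mat_mult_mat: "mat p ** mat q = (mat (p * q) :: 'a::semiring_1^'n^'n)"
  unfolding mat_mult_left by (simp add: mat_def vec_eq_iff)

lemma mat_commute: "mat c ** A = A ** (mat c :: 'a::comm_semiring_1^'n^'n)"
  by (simp add: vec_eq_iff matrix_matrix_mult_def mat_def if_distrib if_distribR mult.commute
      cong: if_cong)

lemma matrix_inv_eqI:
  fixes A :: "'a::semiring_1^'n^'n"
  assumes "A ** B = mat 1" "B ** A = mat 1"
  shows "matrix_inv A = B"
proof -
  have "A ** matrix_inv A = mat 1 \<and> matrix_inv A ** A = mat 1"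
    unfolding matrix_inv_def by (rule someI[of _ B]) (simp add: assms)
  thus ?thesis
    using assms(2) by (metis matrix_mul_assoc matrix_mul_lid matrix_mul_rid)
qed

text \<open>Turns every pairing into the integral of one \<open>gauss_fun\<close>, so that
  identities between inner products become identities of matrix polynomials modulo
  \<open>gauss_deriv\<close>.\<close>

lemma weight_inner_gauss:
  "weight_inner (-\<infinity>) \<infinity> (gauss_fun M) (matpoly_fun P) (matpoly_fun Q) =
    gauss_integral (P ** M ** matpoly_adj Q)"
  by (simp add: weight_inner_def gauss_integral_def set_lebesgue_integral_def gauss_fun_def[abs_def]
      matpoly_fun_mult matpoly_fun_adj scaleR_matrix_mult_left scaleR_matrix_mult_right)

lemma set_integrable_gauss:
  "set_integrable lborel (einterval (-\<infinity>) \<infinity>)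
     (\<lambda>x. matpoly_fun P x ** gauss_fun M x ** conj_transpose (matpoly_fun Q x))"
  using integrable_gauss_fun[of "P ** M ** matpoly_adj Q"]
  by (simp add: set_integrable_def gauss_fun_def[abs_def]
      matpoly_fun_mult matpoly_fun_adj scaleR_matrix_mult_left scaleR_matrix_mult_right)

lemma positive_definite_scaleR:
  assumes "c > 0" "positive_definite A"
  shows "positive_definite (c *\<^sub>R A)"
proof -
  have "(\<Sum>i\<in>UNIV. \<Sum>j\<in>UNIV. cnj (v $ i) * (c *\<^sub>R A) $ i $ j * v $ j) =
      c *\<^sub>R (\<Sum>i\<in>UNIV. \<Sum>j\<in>UNIV. cnj (v $ i) * A $ i $ j * v $ j)" for v
    by (simp add: scaleR_sum_right)
  thus ?thesis
    using assms by (auto simp: positive_definite_def conj_transpose_def vec_eq_iff)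
qed

lemma weight_matrix_gauss_fun:
  assumes "\<And>x. positive_definite (matpoly_fun M x)"
  shows "weight_matrix (-\<infinity>) \<infinity> (gauss_fun M)"
proof -
  \<comment> \<open>Absorbing x^n into the polynomial factor makes each moment integrand another
    \<open>gauss_fun\<close>.\<close>
  have "matpoly_fun (mat (monom 1 n) ** M) x = x ^ n *\<^sub>R matpoly_fun M x" for n x
    by (simp add: matpoly_fun_mult matpoly_fun_mat poly_monom mat_mult_left vec_eq_iff)
       (simp add: matpoly_fun_def poly_monom scaleR_conv_of_real)
  hence "integrable lborel (\<lambda>x. x ^ n *\<^sub>R gauss_fun M x)" for n
    using integrable_gauss_fun[of "mat (monom 1 n) ** M"]
    by (simp add: gauss_fun_def[abs_def] mult.commute)
  moreover have "positive_definite (gauss_fun M x)" for x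
    unfolding gauss_fun_def by (intro positive_definite_scaleR assms) auto
  ultimately show ?thesis
    by (auto simp: weight_matrix_def smooth_fun_on_gauss_fun set_integrable_def)
qed

section \<open>The monic Hermite polynomials\<close>

text \<open>These are H_n / 2^n for the physicists' H_n. The recursion is the raising operator,
  which steps back by one index only.\<close>

fun hermite_monic :: "nat \<Rightarrow> complex poly" where
  "hermite_monic 0 = 1"
| "hermite_monic (Suc n) = [:0, 1:] * hermite_monic n - smult (1 / 2) (pderiv (hermite_monic n))"

text \<open>Differentiating the recursion and inserting the induction hypothesis leaves h_(n+1) plus
  n + 1 times the right side of the recursion, which is h_(n+1) again.\<close>

lemma pderiv_hermite_monic_Suc:
  "pderiv (hermite_monic (Suc n)) = smult (of_nat (Suc n)) (hermite_monic n)"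
proof (induction n)
  case (Suc n)
  have "pderiv (hermite_monic (Suc (Suc n))) =
      hermite_monic (Suc n) + smult (of_nat (Suc n))
        ([:0, 1:] * hermite_monic n - smult (1 / 2) (pderiv (hermite_monic n)))"
    unfolding hermite_monic.simps(2)[of "Suc n"] pderiv_diff pderiv_smult pderiv_mult Suc
    by (simp add: pderiv_pCons smult_diff_right)
  also have "[:0, 1:] * hermite_monic n - smult (1 / 2) (pderiv (hermite_monic n)) =
      hermite_monic (Suc n)"
    by simp
  finally show ?case
    by (simp only: of_nat_Suc smult_add_left smult_1_left)
qed (simp add: pderiv_pCons)

text \<open>For n = m + 1 the derivative lowers h_n to n h_m, and the remaining h_m' - 2 x h_m is -2
  h_(m+1) by the recursion.\<close>

lemma hermite_monic_ode:
  "pderiv (pderiv (hermite_monic n)) - [:0, 2:] * pderiv (hermite_monic n) =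
     smult (- 2 * of_nat n) (hermite_monic n)"
proof (cases n)
  case (Suc m)
  show ?thesis
    unfolding Suc pderiv_hermite_monic_Suc pderiv_smult
    by (simp add: poly_eq_iff coeff_pCons algebra_simps split: nat.splits)
qed simp

lemma coeff_hermite_monic: "coeff (hermite_monic n) n = 1" "n < k \<Longrightarrow> coeff (hermite_monic n) k = 0"
proof (induction n arbitrary: k)
  case 0
  { case 1 thus ?case by simp }
  { case 2 thus ?case by simp }
next
  case (Suc n)
  { case 1 thus ?case by (simp add: Suc coeff_pderiv) }
  { case 2 thus ?case by (cases k) (auto simp: Suc coeff_pderiv) }
qed

lemma map_poly_cnj_hermite_monic: "map_poly cnj (hermite_monic n) = hermite_monic n"
proof (induction n)
  case (Suc n)
  have "cnj (coeff (hermite_monic n) k) = coeff (hermite_monic n) k" for k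
    using Suc by (metis coeff_map_poly complex_cnj_zero)
  thus ?case
    by (simp add: poly_eq_iff coeff_map_poly coeff_pderiv coeff_pCons split: nat.splits)
qed simp

text \<open>The Sturm-Liouville argument: two eigenfunctions of the Hermite operator with distinct
  eigenvalues have a product that is a Gaussian derivative of a multiple of their Wronskian.\<close>

lemma hermite_monic_orthogonal:
  assumes "m \<noteq> n"
  shows "gauss_integral (mat (hermite_monic m * hermite_monic n) :: 'n::finite matpoly) = 0"
proof -
  \<comment> \<open>The eigenvalues -2 m and -2 n differ by 2 (n - m), and \<open>c\<close> is the
    inverse of this difference.\<close>
  define c :: complex where "c = 1 / (2 * (of_nat n - of_nat m))"
  define g where "g = smult c (pderiv (hermite_monic m) * hermite_monic n -
     hermite_monic m * pderiv (hermite_monic n))"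
  have "pderiv g - [:0, 2:] * g = smult c (
      (pderiv (pderiv (hermite_monic m)) - [:0, 2:] * pderiv (hermite_monic m)) * hermite_monic n -
      hermite_monic m * (pderiv (pderiv (hermite_monic n)) - [:0, 2:] * pderiv (hermite_monic n)))"
    by (simp add: g_def pderiv_smult pderiv_diff pderiv_mult algebra_simps smult_diff_right
        smult_add_right)
  also have "\<dots> = smult (c * (2 * (of_nat n - of_nat m))) (hermite_monic m * hermite_monic n)"
    unfolding hermite_monic_ode by (simp add: algebra_simps poly_eq_iff)
  also have "c * (2 * (of_nat n - of_nat m)) = 1"
    using assms by (simp add: c_def)
  finally have "gauss_deriv (mat g :: 'n matpoly) = mat (hermite_monic m * hermite_monic n)"
    by (simp add: gauss_deriv_def matpoly_deriv_def mat_def vec_eq_iff)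
  thus ?thesis
    using gauss_integral_gauss_deriv by metis
qed

text \<open>Scalar matrices are closed under products and adjoints, so the scalar Hermite facts
  carry over.\<close>

lemma monic_orthogonal_hermite:
  "monic_orthogonal (-\<infinity>) \<infinity> (gauss_fun (mat 1)) (\<lambda>n. mat (hermite_monic n) :: 'n::finite matpoly)"
proof -
  have coeff: "matpoly_coeff (mat p :: 'n matpoly) k = mat (coeff p k)" for p k
    by (simp add: matpoly_coeff_def mat_def vec_eq_iff)
  have "(mat 1 :: complex^'n^'n) \<noteq> 0"
    by (simp add: mat_def vec_eq_iff)
  moreover have "matpoly_adj (mat p :: 'n matpoly) = mat (map_poly cnj p)" for p
    by (simp add: matpoly_adj_def mat_def vec_eq_iff)
  ultimately show ?thesis
    by (auto simp: monic_orthogonal_def weight_inner_gauss coeff coeff_hermite_monic mat_mult_mat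
        map_poly_cnj_hermite_monic hermite_monic_orthogonal intro!: matpoly_degree_eqI)
qed

section \<open>Operators of order one and two, their composition and adjoint\<close>

lemma diffop_poly_order1: "B \<noteq> 0 \<Longrightarrow> diffop_poly P [:A, B:] = P ** A + matpoly_deriv P ** B"
  by (simp add: diffop_poly_altdef)

lemma diffop_poly_order2:
  "C \<noteq> 0 \<Longrightarrow> diffop_poly P [:A, B, C:] =
     P ** A + matpoly_deriv P ** B + matpoly_deriv (matpoly_deriv P) ** C"
  by (simp add: diffop_poly_altdef numeral_2_eq_2)

lemma diffop_fun_order1: "diffop_fun Q [f, g] x = Q x ** f x + nderiv 1 Q x ** g x"
  by (simp add: diffop_fun_def)

lemma diffop_fun_order2:
  "diffop_fun Q [f, g, h] x = Q x ** f x + nderiv 1 Q x ** g x + nderiv 2 Q x ** h x"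
  by (simp add: diffop_fun_def numeral_2_eq_2)

lemma diffop_fun_matpoly:
  "diffop_fun (matpoly_fun Q) [matpoly_fun A, matpoly_fun B] = matpoly_fun (Q ** A + matpoly_deriv Q ** B)"
  using nderiv_matpoly_fun[of 1 Q]
  by (simp add: fun_eq_iff diffop_fun_order1 matpoly_fun_add matpoly_fun_mult)

text \<open>With R = Q + Q' F one has R' = Q' + Q' F' + Q'' F; collecting R A + R' B by derivatives
  of Q gives the three coefficients.\<close>

lemma diffop_fun_order1_comp:
  assumes Q: "(Q has_vector_derivative nderiv 1 Q x) (at x)"
    "(nderiv 1 Q has_vector_derivative nderiv 2 Q x) (at x)"
  shows "diffop_fun (diffop_fun Q [matpoly_fun (mat 1), matpoly_fun F]) [matpoly_fun A, matpoly_fun B] x =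
    diffop_fun Q (map matpoly_fun [A, F ** A + B + matpoly_deriv F ** B, F ** B]) x"
proof -
  define R where "R = diffop_fun Q [matpoly_fun (mat 1), matpoly_fun F]"
  have R: "R = (\<lambda>x. Q x + nderiv 1 Q x ** matpoly_fun F x)"
    by (simp add: R_def fun_eq_iff diffop_fun_order1 matpoly_fun_mat)
  have "(R has_vector_derivative nderiv 1 Q x +
      (nderiv 1 Q x ** matpoly_fun (matpoly_deriv F) x + nderiv 2 Q x ** matpoly_fun F x)) (at x)"
    unfolding R
    by (intro has_vector_derivative_add has_vector_derivative_matrix_mult Q
        has_vector_derivative_matpoly_fun)
  hence "nderiv 1 R x = nderiv 1 Q x +
      (nderiv 1 Q x ** matpoly_fun (matpoly_deriv F) x + nderiv 2 Q x ** matpoly_fun F x)"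
    using nderiv_Suc[of 0 R x] by (simp add: vector_derivative_at)
  thus ?thesis
    unfolding R_def[symmetric]
    by (simp add: diffop_fun_order1 diffop_fun_order2 R matpoly_fun_add matpoly_fun_mult
        matrix_add_ldistrib matrix_add_rdistrib matrix_mul_assoc)
qed

lemma weighted_adjoint_gauss_order1:
  assumes Q: "(Q has_vector_derivative nderiv 1 Q x) (at x)"
    and "F \<noteq> 0" and F: "M ** matpoly_adj F = - B"
  shows "weighted_adjoint (gauss_fun (mat 1)) (gauss_fun M) [:mat 1, F:] Q x =
    diffop_fun Q [matpoly_fun (M + gauss_deriv B), matpoly_fun B] x"
proof -
  let ?e = "exp (- (x ^ 2))"
  have "matrix_inv (?e *\<^sub>R mat 1 :: complex^'a^'a) = exp (x ^ 2) *\<^sub>R mat 1"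
    by (rule matrix_inv_eqI)
       (simp_all add: scaleR_matrix_mult_left scaleR_matrix_mult_right exp_minus)
  hence inv: "matrix_inv (gauss_fun (mat 1) x :: complex^'a^'a) = exp (x ^ 2) *\<^sub>R mat 1"
    by (simp add: gauss_fun_def matpoly_fun_mat)
  have "gauss_fun M t ** conj_transpose (matpoly_fun F t) = - gauss_fun B t" for t
    unfolding gauss_fun_def scaleR_matrix_mult_left matpoly_fun_adj[symmetric]
      matpoly_fun_mult[symmetric] F by (simp add: matpoly_fun_minus)
  hence eq: "(\<lambda>t. Q t ** gauss_fun M t ** conj_transpose (matpoly_fun F t)) = (\<lambda>t. - (Q t ** gauss_fun B t))"
    by (simp add: matrix_mul_assoc[symmetric] matrix_minus_right)
  have "((\<lambda>t. - (Q t ** gauss_fun B t)) has_vector_derivative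
      - (Q x ** gauss_fun (gauss_deriv B) x + nderiv 1 Q x ** gauss_fun B x)) (at x)"
    by (intro has_vector_derivative_minus has_vector_derivative_matrix_mult Q
        has_vector_derivative_gauss_fun)
  hence d: "nderiv 1 (\<lambda>t. - (Q t ** gauss_fun B t)) x =
      - (Q x ** gauss_fun (gauss_deriv B) x + nderiv 1 Q x ** gauss_fun B x)"
    using nderiv_Suc[of 0 "\<lambda>t. - (Q t ** gauss_fun B t)" x] by (simp add: vector_derivative_at)
  have one: "conj_transpose (mat 1) = (mat 1 :: complex^'a^'a)"
    by (simp add: conj_transpose_def mat_def vec_eq_iff)
  have "weighted_adjoint (gauss_fun (mat 1)) (gauss_fun M) [:mat 1, F:] Q x =
     (Q x ** gauss_fun M x + (Q x ** gauss_fun (gauss_deriv B) x + nderiv 1 Q x ** gauss_fun B x))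
       ** (exp (x ^ 2) *\<^sub>R mat 1)"
    using \<open>F \<noteq> 0\<close> d by (simp add: weighted_adjoint_def inv eq matpoly_fun_mat one add.commute)
  also have "\<dots> = diffop_fun Q [matpoly_fun (M + gauss_deriv B), matpoly_fun B] x"
    by (simp add: gauss_fun_def scaleR_matrix_mult_left scaleR_matrix_mult_right scaleR_add_right
        mult_exp_exp diffop_fun_order1 matpoly_fun_add matrix_add_ldistrib)
  finally show ?thesis .
qed

text \<open>A product rule for three factors in which the term -2 x occurs only once; being scalar,
  it can be assigned to the middle factor.\<close>

lemma gauss_deriv_sandwich:
  "gauss_deriv (P ** B ** Q) =
    matpoly_deriv P ** B ** Q + P ** gauss_deriv B ** Q + P ** B ** matpoly_deriv Q"
proof -
  define E where "E = (mat [:0, 2:] :: 'a matpoly)"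
  have E: "gauss_deriv R = matpoly_deriv R - E ** R" for R
    by (simp add: gauss_deriv_def E_def mat_mult_left)
  have "P ** (E ** B) ** Q = E ** (P ** B ** Q)"
    by (metis E_def mat_commute matrix_mul_assoc)
  thus ?thesis
    unfolding E matpoly_deriv_mult
    by (simp add: matrix_add_ldistrib matrix_add_rdistrib matrix_mul_assoc diff_conv_add_uminus
        matrix_minus_left matrix_minus_right del: add_uminus_conv_diff)
qed

text \<open>The two integrands differ by \<open>gauss_deriv (P ** B ** matpoly_adj Q)\<close>, which
  integrates to zero.\<close>

lemma gauss_integral_adjoint:
  assumes "F ** M = - B" "matpoly_adj B = B" and A: "A = M + gauss_deriv B" "matpoly_adj A = A"
  shows "gauss_integral ((P ** mat 1 + matpoly_deriv P ** F) ** M ** matpoly_adj Q) =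
    gauss_integral (P ** mat 1 ** matpoly_adj (Q ** A + matpoly_deriv Q ** B))"
proof -
  let ?Q = "matpoly_adj Q"
  have "P ** mat 1 ** matpoly_adj (Q ** A + matpoly_deriv Q ** B) = P ** A ** ?Q + P ** B ** matpoly_deriv ?Q"
    by (simp add: assms(2,4) matpoly_adj_add matpoly_adj_mult matpoly_adj_deriv matrix_add_ldistrib
        matrix_mul_assoc)
  also have "\<dots> = (P ** mat 1 + matpoly_deriv P ** F) ** M ** ?Q + gauss_deriv (P ** B ** ?Q)"
    by (simp add: A(1) matrix_add_ldistrib matrix_add_rdistrib matrix_mul_assoc[symmetric] assms(1)
        gauss_deriv_sandwich[unfolded matrix_mul_assoc[symmetric]] matrix_minus_left
        matrix_minus_right diff_conv_add_uminus del: add_uminus_conv_diff)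
  finally show ?thesis
    by (simp add: gauss_integral_add gauss_integral_gauss_deriv)
qed

section \<open>The explicit weight and operators\<close>

definition darboux_weight :: "real \<Rightarrow> 2 matpoly" where
  "darboux_weight a = vector [vector [[:1, 0, of_real (a ^ 2):], [:0, of_real a:]],
     vector [[:0, of_real a:], 1]]"

text \<open>The coefficient F of V = I + d F.\<close>

definition darboux_V1 :: "real \<Rightarrow> 2 matpoly" where
  "darboux_V1 a = vector [vector [0, [:- of_real a / 2:]],
     vector [[:- of_real a / 2:], [:0, of_real (a ^ 2) / 2:]]]"

text \<open>With \<open>darboux_N1\<close>, which is the matrix B, this forms the adjoint operator N
  = \<open>darboux_N0\<close> + d B.\<close>

definition darboux_N0 :: "real \<Rightarrow> 2 matpoly" where
  "darboux_N0 a = vector [vector [[:1 + of_real (a ^ 2) / 2:], 0], vector [0, 1]]"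

definition darboux_N1 :: "real \<Rightarrow> 2 matpoly" where
  "darboux_N1 a = vector [vector [[:0, of_real (a ^ 2) / 2:], [:of_real a / 2:]],
     vector [[:of_real a / 2:], 0]]"

lemmas darboux_defs = darboux_weight_def darboux_V1_def darboux_N0_def darboux_N1_def

lemma darboux_self_adjoint:
  "matpoly_adj (darboux_V1 a) = darboux_V1 a"
  "matpoly_adj (darboux_N0 a) = darboux_N0 a"
  "matpoly_adj (darboux_N1 a) = darboux_N1 a"
  by (simp_all add: darboux_defs matpoly_adj_def vec_eq_iff forall_2 map_poly_pCons)

text \<open>This order of the factors enters the pairing identity; the reverse order below enters
  the formula for the weighted adjoint.\<close>

lemma darboux_V1_weight: "darboux_V1 a ** darboux_weight a = - darboux_N1 a"
  by (simp add: darboux_defs vec_eq_iff forall_2 matrix_matrix_mult_def sum_2 power2_eq_square)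

lemma darboux_weight_V1: "darboux_weight a ** darboux_V1 a = - darboux_N1 a"
  by (simp add: darboux_defs vec_eq_iff forall_2 matrix_matrix_mult_def sum_2 power2_eq_square)

lemma darboux_N0_eq: "darboux_N0 a = darboux_weight a + gauss_deriv (darboux_N1 a)"
  by (simp add: darboux_defs vec_eq_iff forall_2 gauss_deriv_def matpoly_deriv_def pderiv_pCons)

text \<open>The coefficient of d in V N. It is a scalar matrix, as is the coefficient of d^2 below,
  so V N is diagonal.\<close>

lemma darboux_D1:
  "darboux_V1 a ** darboux_N0 a + darboux_N1 a + matpoly_deriv (darboux_V1 a) ** darboux_N1 a =
     mat [:0, of_real (a ^ 2) / 2:]"
  by (simp add: darboux_defs vec_eq_iff forall_2 matrix_matrix_mult_def sum_2 power2_eq_square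
      matpoly_deriv_def pderiv_pCons mat_def field_simps)

lemma darboux_D2: "darboux_V1 a ** darboux_N1 a = mat [:- of_real (a ^ 2) / 4:]"
  by (simp add: darboux_defs vec_eq_iff forall_2 matrix_matrix_mult_def sum_2 power2_eq_square
      mat_def)

lemma positive_definite_darboux_weight: "positive_definite (matpoly_fun (darboux_weight a) x)"
  unfolding positive_definite_def
proof (intro conjI allI impI)
  show "conj_transpose (matpoly_fun (darboux_weight a) x) = matpoly_fun (darboux_weight a) x"
    by (simp add: conj_transpose_def matpoly_fun_def darboux_defs vec_eq_iff forall_2)
  fix v :: "complex^2" assume v: "v \<noteq> 0"
  \<comment> \<open>This is the squared norm of T* v, from the factorization T T* of the polynomial
    part of the weight.\<close>
  have "Re (\<Sum>i\<in>UNIV. \<Sum>j\<in>UNIV. cnj (v $ i) * matpoly_fun (darboux_weight a) x $ i $ j * v $ j) =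
      (cmod (v $ 1))\<^sup>2 + (cmod (of_real (a * x) * v $ 1 + v $ 2))\<^sup>2"
    unfolding cmod_power2
    by (simp add: sum_2 matpoly_fun_def darboux_defs power2_eq_square algebra_simps)
  also have "\<dots> > 0"
  proof (cases "v $ 1 = 0")
    case True
    with v have "v $ 2 \<noteq> 0"
      by (auto simp: vec_eq_iff forall_2)
    with True show ?thesis
      by simp
  qed (simp add: add_pos_nonneg)
  finally show "0 < Re (\<Sum>i\<in>UNIV. \<Sum>j\<in>UNIV.
      cnj (v $ i) * matpoly_fun (darboux_weight a) x $ i $ j * v $ j)" .
qed

lemma positive_definite_mat_1: "positive_definite (mat 1 :: complex^'n::finite^'n)"
  unfolding positive_definite_def
proof (intro conjI allI impI)
  show "conj_transpose (mat 1) = (mat 1 :: complex^'n^'n)"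
    by (simp add: conj_transpose_def mat_def vec_eq_iff)
  fix v :: "complex^'n" assume v: "v \<noteq> 0"
  then obtain k where k: "v $ k \<noteq> 0"
    by (auto simp: vec_eq_iff)
  have "(\<Sum>i\<in>UNIV. \<Sum>j\<in>UNIV. cnj (v $ i) * mat 1 $ i $ j * v $ j) =
      (\<Sum>i\<in>UNIV. cnj (v $ i) * v $ i)"
    by (simp add: mat_def if_distrib if_distribR cong: if_cong)
  also have "\<dots> = of_real (\<Sum>i\<in>UNIV. (cmod (v $ i))\<^sup>2)"
    unfolding of_real_sum by (intro sum.cong) (simp_all only: complex_norm_square mult.commute)
  finally show "0 < Re (\<Sum>i\<in>UNIV. \<Sum>j\<in>UNIV. cnj (v $ i) * mat 1 $ i $ j * v $ j)"
    using k by (auto intro!: sum_pos2[of _ k])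
qed

lemma darboux_V1_nonzero: "a \<noteq> 0 \<Longrightarrow> darboux_V1 a \<noteq> 0"
  by (simp add: darboux_defs vec_eq_iff forall_2)

text \<open>F has degree one, so d F does not raise degrees. On the coefficient of x^n at the top, V
  multiplies the two columns by 1 and 1 + n a^2 / 2, neither of which vanishes.\<close>

lemma degree_preserving_darboux:
  assumes "a \<noteq> 0"
  shows "degree_preserving [:mat 1, darboux_V1 a:]"
proof -
  have act: "diffop_poly P [:mat 1, darboux_V1 a:] = P + matpoly_deriv P ** darboux_V1 a" for P
    by (simp add: diffop_poly_order1 darboux_V1_nonzero assms)
  have coeff1: "matpoly_coeff (P + matpoly_deriv P ** darboux_V1 a) k $ i $ 1 =
      matpoly_coeff P k $ i $ 1 - of_nat (Suc k) * of_real a / 2 * matpoly_coeff P (Suc k) $ i $ 2"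
    for P k i
    by (simp add: matpoly_coeff_def matrix_matrix_mult_def sum_2 matpoly_deriv_def darboux_defs
        coeff_pderiv)
  have coeff2: "matpoly_coeff (P + matpoly_deriv P ** darboux_V1 a) k $ i $ 2 =
      (1 + of_nat k * of_real (a ^ 2) / 2) * matpoly_coeff P k $ i $ 2 -
      of_nat (Suc k) * of_real a / 2 * matpoly_coeff P (Suc k) $ i $ 1"
    for P k i
    by (cases k) (simp_all add: matpoly_coeff_def matrix_matrix_mult_def sum_2 matpoly_deriv_def
        darboux_defs coeff_pderiv algebra_simps
        add_divide_distrib)
  have nz: "1 + of_nat k * of_real (a ^ 2) / 2 \<noteq> (0 :: complex)" for k
  proof -
    have "1 + real k * a ^ 2 / 2 \<noteq> 0"
      by (smt (verit) divide_nonneg_nonneg mult_nonneg_nonneg of_nat_0_le_iff zero_le_power2)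
    hence "complex_of_real (1 + real k * a ^ 2 / 2) \<noteq> 0"
      by (subst of_real_eq_0_iff)
    thus ?thesis by simp
  qed
  show ?thesis
  proof (rule degree_preservingI; unfold act)
    fix P :: "2 matpoly" and n
    assume z: "\<And>k. n < k \<Longrightarrow> matpoly_coeff P k = 0"
    thus "\<forall>k>n. matpoly_coeff (P + matpoly_deriv P ** darboux_V1 a) k = 0"
      by (simp add: vec_eq_iff forall_2 coeff1 coeff2)
    assume "matpoly_coeff P n \<noteq> 0"
    thus "matpoly_coeff (P + matpoly_deriv P ** darboux_V1 a) n \<noteq> 0"
      using nz by (auto simp: vec_eq_iff forall_2 coeff1 coeff2 z)
  qed (simp add: matpoly_deriv_def vec_eq_iff matrix_matrix_mult_def)
qed

text \<open>The terms with d and d^2 form -a^2 / 4 times the Hermite operator, with eigenvalue a^2 n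
  / 2 on h_n; the order zero term is a constant diagonal matrix.\<close>

lemma darboux_diffop_algebra:
  assumes "a \<noteq> 0"
  shows "[:darboux_N0 a, mat [:0, of_real (a ^ 2) / 2:], mat [:- of_real (a ^ 2) / 4:]:] \<in>
    diffop_algebra (-\<infinity>) \<infinity> (gauss_fun (mat 1))"
proof -
  have "\<exists>L. diffop_poly (mat (hermite_monic n))
        [:darboux_N0 a, mat [:0, of_real (a ^ 2) / 2:], mat [:- of_real (a ^ 2) / 4:]:] =
      const_matpoly L ** mat (hermite_monic n)" for n
  proof -
    define c where "c = complex_of_real (a ^ 2)"
    have nz: "mat [:- c / 4:] \<noteq> (0 :: 2 matpoly)"
      using assms by (simp add: c_def mat_def vec_eq_iff)
    have deriv: "matpoly_deriv (mat p :: 2 matpoly) = mat (pderiv p)" for p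
      by (simp add: matpoly_deriv_def mat_def vec_eq_iff)
    have "[:0, c / 2:] * pderiv (hermite_monic n) + [:- c / 4:] * pderiv (pderiv (hermite_monic n)) =
        smult (- c / 4) (pderiv (pderiv (hermite_monic n)) - [:0, 2:] * pderiv (hermite_monic n))"
      by (simp add: poly_eq_iff coeff_pCons algebra_simps split: nat.splits)
    also have "\<dots> = [:c * of_nat n / 2:] * hermite_monic n"
      unfolding hermite_monic_ode by (simp add: field_simps)
    finally have ode: "pderiv (hermite_monic n) * [:0, c / 2:] +
        pderiv (pderiv (hermite_monic n)) * [:- c / 4:] = [:c * of_nat n / 2:] * hermite_monic n"
      by (simp only: mult.commute)
    define L where "L = (vector [vector [1 + c / 2 + c * of_nat n / 2, 0],
      vector [0, 1 + c * of_nat n / 2]] :: complex^2^2)"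
    have L: "const_matpoly L = darboux_N0 a + mat [:c * of_nat n / 2:]"
      by (simp add: const_matpoly_def L_def darboux_N0_def c_def mat_def vec_eq_iff forall_2 one_pCons)
    have "diffop_poly (mat (hermite_monic n)) [:darboux_N0 a, mat [:0, c / 2:], mat [:- c / 4:]:] =
        mat (hermite_monic n) ** darboux_N0 a + (mat (pderiv (hermite_monic n) * [:0, c / 2:]) +
        mat (pderiv (pderiv (hermite_monic n)) * [:- c / 4:]))"
      unfolding diffop_poly_order2[OF nz] deriv mat_mult_mat by (simp only: add.assoc)
    also have "mat (pderiv (hermite_monic n) * [:0, c / 2:]) +
        mat (pderiv (pderiv (hermite_monic n)) * [:- c / 4:]) =
        (mat ([:c * of_nat n / 2:] * hermite_monic n) :: 2 matpoly)"
      unfolding ode[symmetric] by (simp add: mat_def vec_eq_iff)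
    \<comment> \<open>Here the right action becomes left multiplication by \<open>L\<close>: the
      scalar matrix of h_n commutes with \<open>darboux_N0 a\<close>.\<close>
    also have "mat (hermite_monic n) ** darboux_N0 a + mat ([:c * of_nat n / 2:] * hermite_monic n) =
        const_matpoly L ** mat (hermite_monic n)"
      unfolding L matrix_add_rdistrib mat_mult_mat by (simp only: mat_commute)
    finally show ?thesis
      unfolding c_def by blast
  qed
  thus ?thesis
    unfolding diffop_algebra_def using monic_orthogonal_hermite by blast
qed

theorem proposition5p11:
  fixes a :: real
  assumes "a \<noteq> 0"
  shows "strong_darboux_transformation (-\<infinity>) \<infinity>
           (\<lambda>x. exp (- (x ^ 2)) *\<^sub>R (mat 1 :: complex^2^2))
           (\<lambda>x. exp (- (x ^ 2)) *\<^sub>R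
             (vector [vector [of_real (1 + a ^ 2 * x ^ 2), of_real (a * x)],
                      vector [of_real (a * x), 1]] :: complex^2^2))"
proof -
  let ?V = "[:mat 1, darboux_V1 a:]"
  let ?N = "[matpoly_fun (darboux_N0 a), matpoly_fun (darboux_N1 a)]"
  let ?D = "[:darboux_N0 a, mat [:0, of_real (a ^ 2) / 2:], mat [:- of_real (a ^ 2) / 4:]:]"
  have V1: "darboux_V1 a \<noteq> 0"
    using assms by (rule darboux_V1_nonzero)
  have W1: "(\<lambda>x. exp (- (x ^ 2)) *\<^sub>R (mat 1 :: complex^2^2)) = gauss_fun (mat 1)"
    by (simp add: fun_eq_iff gauss_fun_def matpoly_fun_mat)
  have W2: "(\<lambda>x. exp (- (x ^ 2)) *\<^sub>R
      (vector [vector [of_real (1 + a ^ 2 * x ^ 2), of_real (a * x)],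
               vector [of_real (a * x), 1]] :: complex^2^2)) = gauss_fun (darboux_weight a)"
    by (simp add: fun_eq_iff gauss_fun_def matpoly_fun_def darboux_weight_def vec_eq_iff forall_2
        power2_eq_square mult_ac)
  have "weight_matrix (-\<infinity>) \<infinity> (gauss_fun (mat 1 :: 2 matpoly))"
    by (rule weight_matrix_gauss_fun) (simp add: matpoly_fun_mat positive_definite_mat_1)
  moreover have "weight_matrix (-\<infinity>) \<infinity> (gauss_fun (darboux_weight a))"
    by (intro weight_matrix_gauss_fun positive_definite_darboux_weight)
  \<comment> \<open>The leading coefficient is F, whose determinant is the nonzero constant -a^2 /
    4.\<close>
  moreover have "det (lead_coeff ?V) \<noteq> 0"
    using V1 assms by (simp add: det_2 darboux_V1_def)
  moreover have "diffop_fun Q ?N x = weighted_adjoint (gauss_fun (mat 1)) (gauss_fun (darboux_weight a)) ?V Q x"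
    if "smooth_fun_on (einterval (-\<infinity>) \<infinity>) Q" for Q x
    using weighted_adjoint_gauss_order1[of Q x "darboux_V1 a" "darboux_weight a" "darboux_N1 a"]
      smooth_fun_on_nderiv[OF that, of x 0] V1
    by (simp add: darboux_self_adjoint darboux_weight_V1 darboux_N0_eq)
  moreover have "diffop_fun Q (fun_coeffs ?D) x = diffop_fun (diffop_fun Q (fun_coeffs ?V)) ?N x"
    if "smooth_fun_on (einterval (-\<infinity>) \<infinity>) Q" for Q x
  proof -
    \<comment> \<open>A nonzero top coefficient ensures that the coefficient list of
      \<open>?D\<close> has exactly three entries.\<close>
    have "mat [:- of_real (a ^ 2) / 4:] \<noteq> (0 :: 2 matpoly)"
      using assms by (simp add: mat_def vec_eq_iff)
    hence "fun_coeffs ?D = map matpoly_fun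
        [darboux_N0 a, mat [:0, of_real (a ^ 2) / 2:], mat [:- of_real (a ^ 2) / 4:]]"
      by (simp add: fun_coeffs_def cCons_def)
    moreover have "fun_coeffs ?V = [matpoly_fun (mat 1), matpoly_fun (darboux_V1 a)]"
      using V1 by (simp add: fun_coeffs_def cCons_def)
    ultimately show ?thesis
      using diffop_fun_order1_comp[of Q x "darboux_V1 a" "darboux_N0 a" "darboux_N1 a"]
        smooth_fun_on_nderiv[OF that, of x 0] smooth_fun_on_nderiv[OF that, of x 1]
      by (simp add: darboux_D1 darboux_D2 numeral_2_eq_2)
  qed
  \<comment> \<open>\<open>?N\<close> maps polynomials to polynomials, so the integrand is a
    Gaussian times a matrix polynomial.\<close>
  moreover have "set_integrable lborel (einterval (-\<infinity>) \<infinity>)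
      (\<lambda>x. matpoly_fun P x ** gauss_fun (mat 1) x ** conj_transpose (diffop_fun (matpoly_fun Q) ?N x))"
    for P Q
    unfolding diffop_fun_matpoly by (rule set_integrable_gauss)
  moreover have "weight_inner (-\<infinity>) \<infinity> (gauss_fun (darboux_weight a))
      (matpoly_fun (diffop_poly P ?V)) (matpoly_fun Q) =
    weight_inner (-\<infinity>) \<infinity> (gauss_fun (mat 1)) (matpoly_fun P) (diffop_fun (matpoly_fun Q) ?N)" for P Q
    unfolding diffop_fun_matpoly weight_inner_gauss diffop_poly_order1[OF V1]
    by (intro gauss_integral_adjoint darboux_V1_weight darboux_self_adjoint darboux_N0_eq)
  ultimately show ?thesis
    unfolding strong_darboux_transformation_def W1 W2
    using degree_preserving_darboux[OF assms] darboux_diffop_algebra[OF assms]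
    by (intro conjI exI[of _ ?V] exI[of _ ?N] exI[of _ ?D]) (auto intro: smooth_fun_on_matpoly_fun)
qed

end
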